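(* Let $(X_k)_{k\ge 1}$ be a sequence of real-valued random variables on a probability space $(\Omega,\mathcal{K},P_X)$, and let $Y$ be a real-valued random variable such that, for some constant $M>0$, $$\frac1n\sum_{k=1}^n P(|X_k|>x)\le M\,P(|Y|>x)\quad\text{for all } x>0 \text{ and all integers } n\ge 1.$$ Let $1<p<2$ and suppose $E\left[|Y|^p\log^+|Y|\right]<\infty$. Then $$n^{p/2-1}\, E_{\tilde\theta_n}|S_n(\tilde\theta_n)|^p\to 0\quad P_X\text{-almost surely as } n\to\infty.$$
   Context: For $n\ge 2$, $\tilde\theta_n=(\theta_{n,1},\dots,\theta_{n,n})$ is a random vector distributed uniformly on the unit sphere $\mathbb{S}^{n-1}\subset\mathbb{R}^n$ (i.e. according to the unique rotationally invariant probability measure $P_{\tilde\theta_n}$ on $\mathbb{S}^{n-1}$), independent of $(X_1,\dots,X_n)$, and $S_n(\tilde\theta_n)=\theta_{n,1}X_1+\cdots+\theta_{n,n}X_n$. The symbol $E_{\tilde\theta_n}$ denotes expectation with respect to $P_{\tilde\theta_n}$ only, so that $E_{\tilde\theta_n}|S_n(\tilde\theta_n)|^p$ is the random variable on $\Omega$ given by $\omega\mapsto\int_{\mathbb{S}^{n-1}}\left|\sum_{k=1}^n u_kX_k(\omega)\right|^p dP_{\tilde\theta_n}(u)$. Here $\log^+ x=\max(\log x,0)$ for $x>0$ and $\log^+0=0$. No independence among the $X_k$ is assumed. *)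

theory Defs
  imports "HOL-Probability.Probability"
begin

text \<open>
  The dimension \<open>n\<close> varies inside the statement, so vectors of \<open>n\<close>-space are represented
  as elements of \<open>{1..n} \<rightarrow>\<^sub>E UNIV\<close>.
\<close>

definition unit_sphere :: "nat \<Rightarrow> (nat \<Rightarrow> real) set" where
  "unit_sphere n = {u \<in> {1..n} \<rightarrow>\<^sub>E UNIV. (\<Sum>k=1..n. (u k)\<^sup>2) = 1}"

definition borel_sphere :: "nat \<Rightarrow> (nat \<Rightarrow> real) measure" where
  "borel_sphere n = restrict_space (\<Pi>\<^sub>M k\<in>{1..n}. (borel :: real measure)) (unit_sphere n)"

definition orthogonal_coeffs :: "nat \<Rightarrow> (nat \<Rightarrow> nat \<Rightarrow> real) \<Rightarrow> bool" where
  "orthogonal_coeffs n A \<longleftrightarrow>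
     (\<forall>i\<in>{1..n}. \<forall>j\<in>{1..n}. (\<Sum>k=1..n. A k i * A k j) = (if i = j then 1 else 0))"

definition apply_coeffs :: "nat \<Rightarrow> (nat \<Rightarrow> nat \<Rightarrow> real) \<Rightarrow> (nat \<Rightarrow> real) \<Rightarrow> nat \<Rightarrow> real" where
  "apply_coeffs n A u = (\<lambda>i\<in>{1..n}. \<Sum>j=1..n. A i j * u j)"

text \<open>
  For \<open>n \<ge> 1\<close> exactly one measure satisfies this predicate, the normalised surface measure.
  Rotations are understood as all orthogonal maps; for \<open>n \<ge> 2\<close> requiring invariance only under
  those of determinant one singles out the same measure.
\<close>

definition uniform_on_sphere :: "nat \<Rightarrow> (nat \<Rightarrow> real) measure \<Rightarrow> bool" where
  "uniform_on_sphere n P \<longleftrightarrow>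
     prob_space P \<and> sets P = sets (borel_sphere n) \<and>
     (\<forall>A. orthogonal_coeffs n A \<longrightarrow> distr P P (apply_coeffs n A) = P)"

definition log_plus :: "real \<Rightarrow> real" where
  "log_plus x = (if x > 0 then max (ln x) 0 else 0)"

end

theory Submission
  imports Defs "HOL-Library.Discrete_Functions"
begin

text \<open>
  On the sphere the second moments are \<open>E u\<^sub>i u\<^sub>j = (if i = j then 1 / n else 0)\<close>, because sign changes
  and swaps of coordinates are orthogonal.  Hence \<open>E \<bar>\<langle>u, x\<rangle>\<bar> powr p\<close> is at most
  \<open>2 * (\<bar>x\<bar>\<^sup>2 / n) powr (p / 2)\<close>, and everything reduces to \<open>n powr (- 2 / p) * (\<Sum>k\<le>n. X\<^sub>k\<^sup>2) \<longlonglongrightarrow> 0\<close> almost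
  surely.  By monotonicity it suffices to consider \<open>n = 2 ^ m\<close>.  The truncated sums
  \<open>W\<^sub>m = (\<Sum>k\<le>2 ^ m. min (X\<^sub>k\<^sup>2 / (2 ^ m) powr (2 / p)) 1)\<close> have, by domination and since \<open>2 / p > 1\<close>,
  \<open>\<Sum>m. E W\<^sub>m\<close> bounded by a multiple of \<open>E \<bar>Y\<bar> powr p\<close>, so \<open>W\<^sub>m \<longlonglongrightarrow> 0\<close> almost surely; and as soon as
  \<open>W\<^sub>m < 1\<close> no truncation is active.
\<close>

section \<open>A dyadic series estimate\<close>

text \<open>Indices with \<open>2 ^ m \<le> s\<close> contribute at most \<open>2 ^ m\<close> each,
  hence less than \<open>2 * s\<close> together. Past them the terms start below \<open>s\<close>
  and, as \<open>q > 1\<close>, decay with ratio \<open>2 powr (1 - q)\<close>. The bound is linear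
  in \<open>s\<close> and uniform in \<open>N\<close>, so it can be integrated with
  \<open>s = \<bar>y\<bar> powr p\<close>.\<close>

lemma sum_min_dyadic_powr_le:
  fixes q s :: real
  assumes "q > 1" "s \<ge> 0"
  shows "(\<Sum>m<N. 2 ^ m * min ((s / 2 ^ m) powr q) 1) \<le> (1 / (1 - 2 powr (1 - q)) + 2) * s"
proof -
  \<comment> \<open>\<open>K\<close> is the sum of the geometric series with ratio \<open>r\<close>. In the bound for \<open>s > 1\<close> below,
    the \<open>- 1\<close> makes the induction by halving \<open>s\<close> absorb the leading term.\<close>
  define r where "r = (2 :: real) powr (1 - q)"
  define K where "K = 1 / (1 - r)"
  have "r < 2 powr 0" unfolding r_def using assms by (intro powr_less_mono) auto
  then have r: "r < 1" "r > 0" by (auto simp: r_def)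
  have K: "K = 1 + r * K" "K \<ge> 0" using r by (auto simp: K_def field_simps)
  define F where "F N s = (\<Sum>m<N. 2 ^ m * min ((s / 2 ^ m) powr q) 1)" for N and s :: real
  have F_Suc: "F (Suc N) s = min (s powr q) 1 + 2 * F N (s / 2)" for N s
    unfolding F_def by (subst sum.lessThan_Suc_shift) (simp add: sum_distrib_left mult_ac)
  have powr_le: "s powr q \<le> s" if "0 \<le> s" "s \<le> 1" for s
    using powr_mono'[of 1 q s] that assms by auto
  have halves: "2 * (s / 2) powr q = r * s powr q" if "s \<ge> 0" for s
    using that by (simp add: r_def powr_divide powr_diff)
  have F_bound: "(s \<le> 1 \<longrightarrow> F N s \<le> K * s powr q) \<and> (s > 1 \<longrightarrow> F N s \<le> (K + 2) * s - 1)"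
    if "s \<ge> 0" for s
    using that
  proof (induction N arbitrary: s)
    case 0
    have "(K + 2) * s - 1 \<ge> 0" if "s > 1"
      using that K(2) mult_mono[of 2 "K + 2" 1 s] by simp
    then show ?case using K(2) by (simp add: F_def)
  next
    case (Suc N)
    show ?case
    proof (intro conjI impI)
      assume "s \<le> 1"
      then have "F N (s / 2) \<le> K * (s / 2) powr q" using Suc by simp
      then have "F (Suc N) s \<le> s powr q + K * (r * s powr q)"
        unfolding F_Suc halves[OF Suc.prems, symmetric] by (simp add: min.coboundedI1)
      also have "\<dots> = (1 + r * K) * s powr q" by (simp add: algebra_simps)
      finally show "F (Suc N) s \<le> K * s powr q" using K(1) by simp
    next
      assume s: "s > 1"
      show "F (Suc N) s \<le> (K + 2) * s - 1"
      proof (cases "s / 2 \<le> 1")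
        case True
        then have "F N (s / 2) \<le> K * (s / 2) powr q" using Suc by simp
        also have "\<dots> \<le> K * (s / 2)"
          using True s K(2) by (intro mult_left_mono powr_le) auto
        finally have "F (Suc N) s \<le> 1 + K * s" unfolding F_Suc by simp
        \<comment> \<open>The slack \<open>2 * s - 2\<close> between the two bounds is nonnegative
          because \<open>s > 1\<close>.\<close>
        then show ?thesis using s by (simp add: algebra_simps)
      next
        case False
        then have "F N (s / 2) \<le> (K + 2) * (s / 2) - 1"
          using Suc.IH[of "s / 2"] s by simp
        then show ?thesis unfolding F_Suc by (simp add: algebra_simps)
      qed
    qed
  qed
  have "F N s \<le> (K + 2) * s"
  proof (cases "s \<le> 1")
    case True
    then have "F N s \<le> K * s powr q" using F_bound assms by blast
    also have "\<dots> \<le> K * s" using True assms K(2) by (intro mult_left_mono powr_le) auto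
    finally show ?thesis using assms by (simp add: algebra_simps)
  next
    case False
    then have "F N s \<le> (K + 2) * s - 1" using F_bound assms by auto
    then show ?thesis by simp
  qed
  then show ?thesis unfolding F_def K_def r_def .
qed

section \<open>Truncated second moments under domination of tails\<close>

text \<open>The truncated square is the length of the set of \<open>t\<close> in
  \<open>{0<..<1}\<close> with \<open>t < (f \<omega>)\<^sup>2 / a\<close>, and Fubini swaps the two
  integrals. What remains involves tail probabilities only, the quantities that the domination
  hypothesis compares.\<close>

lemma (in prob_space) nn_integral_min_square_layer_cake:
  fixes f :: "'a \<Rightarrow> real" and a :: real
  assumes [measurable]: "f \<in> borel_measurable M" and "a > 0"
  shows "(\<integral>\<^sup>+\<omega>. ennreal (min ((f \<omega>)\<^sup>2 / a) 1) \<partial>M) =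
    (\<integral>\<^sup>+t. indicator {0<..<1} t * ennreal (prob {\<omega> \<in> space M. \<bar>f \<omega>\<bar> > sqrt (a * t)}) \<partial>lborel)"
proof -
  interpret pair_sigma_finite M lborel ..
  let ?G = "\<lambda>\<omega> t. indicator {0<..<1} t * indicator {t. \<bar>f \<omega>\<bar> > sqrt (a * t)} t :: ennreal"
  have [measurable]: "Measurable.pred (M \<Otimes>\<^sub>M lborel) (\<lambda>x. \<bar>f (fst x)\<bar> > sqrt (a * snd x))"
    by measurable
  have "ennreal (min ((f \<omega>)\<^sup>2 / a) 1) = (\<integral>\<^sup>+t. ?G \<omega> t \<partial>lborel)" for \<omega>
  proof -
    have "sqrt (a * t) < \<bar>f \<omega>\<bar> \<longleftrightarrow> t < (f \<omega>)\<^sup>2 / a" for t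
    proof -
      have "sqrt (a * t) < \<bar>f \<omega>\<bar> \<longleftrightarrow> a * t < (f \<omega>)\<^sup>2"
        by (metis real_sqrt_abs real_sqrt_less_iff)
      then show ?thesis using \<open>a > 0\<close> by (simp add: field_simps)
    qed
    then have "?G \<omega> t = indicator {0<..<min ((f \<omega>)\<^sup>2 / a) 1} t" for t
      by (auto simp: indicator_def)
    then show ?thesis using \<open>a > 0\<close> by simp
  qed
  then have "(\<integral>\<^sup>+\<omega>. ennreal (min ((f \<omega>)\<^sup>2 / a) 1) \<partial>M) = (\<integral>\<^sup>+\<omega>. \<integral>\<^sup>+t. ?G \<omega> t \<partial>lborel \<partial>M)"
    by simp
  also have "\<dots> = (\<integral>\<^sup>+t. \<integral>\<^sup>+\<omega>. ?G \<omega> t \<partial>M \<partial>lborel)"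
    by (rule Fubini'[symmetric]) (simp add: indicator_def split_beta')
  also have "\<dots> = (\<integral>\<^sup>+t. indicator {0<..<1} t *
      ennreal (prob {\<omega> \<in> space M. \<bar>f \<omega>\<bar> > sqrt (a * t)}) \<partial>lborel)"
  proof (rule nn_integral_cong)
    fix t :: real
    have "(\<integral>\<^sup>+\<omega>. ?G \<omega> t \<partial>M) = (\<integral>\<^sup>+\<omega>. indicator {0<..<1} t *
        indicator {\<omega> \<in> space M. \<bar>f \<omega>\<bar> > sqrt (a * t)} \<omega> \<partial>M)"
      by (intro nn_integral_cong) (auto simp: indicator_def)
    also have "\<dots> = indicator {0<..<1} t * ennreal (prob {\<omega> \<in> space M. \<bar>f \<omega>\<bar> > sqrt (a * t)})"
      by (simp add: nn_integral_cmult emeasure_eq_measure)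
    finally show "(\<integral>\<^sup>+\<omega>. ?G \<omega> t \<partial>M) = \<dots>" .
  qed
  finally show ?thesis .
qed

text \<open>The tail comparison is integrated over the levels \<open>sqrt (a * t)\<close>: both
  sides become layer-cake integrals, and the average over \<open>k\<close> becomes a sum at the
  price of the factor \<open>n\<close>.\<close>

lemma sum_nn_integral_min_square_le:
  fixes X :: "nat \<Rightarrow> 'a \<Rightarrow> real" and Y :: "'b \<Rightarrow> real"
  assumes "prob_space M" "prob_space N"
    and X: "\<And>k. k \<ge> 1 \<Longrightarrow> X k \<in> borel_measurable M" and Y: "Y \<in> borel_measurable N"
    and "C > 0" "a > 0" "n \<ge> 1"
    and dom: "\<And>x. x > 0 \<Longrightarrow>
           1 / real n * (\<Sum>k=1..n. measure M {\<omega> \<in> space M. \<bar>X k \<omega>\<bar> > x})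
             \<le> C * measure N {\<omega> \<in> space N. \<bar>Y \<omega>\<bar> > x}"
  shows "(\<Sum>k=1..n. \<integral>\<^sup>+\<omega>. ennreal (min ((X k \<omega>)\<^sup>2 / a) 1) \<partial>M)
    \<le> ennreal (C * n) * (\<integral>\<^sup>+\<omega>. ennreal (min ((Y \<omega>)\<^sup>2 / a) 1) \<partial>N)"
proof -
  interpret M: prob_space M by fact
  interpret N: prob_space N by fact
  let ?pX = "\<lambda>k t. M.prob {\<omega> \<in> space M. \<bar>X k \<omega>\<bar> > sqrt (a * t)}"
  let ?pY = "\<lambda>t. N.prob {\<omega> \<in> space N. \<bar>Y \<omega>\<bar> > sqrt (a * t)}"
  have meas: "(\<lambda>t. measure Q {\<omega> \<in> space Q. \<bar>f \<omega>\<bar> > sqrt (a * t)}) \<in> borel_measurable lborel"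
    if "prob_space Q" "f \<in> borel_measurable Q" for Q :: "'c measure" and f :: "'c \<Rightarrow> real"
  proof -
    interpret Q: prob_space Q by fact
    note that(2)[measurable]
    have "(\<lambda>t. measure Q {\<omega> \<in> space Q. \<bar>f \<omega>\<bar> > sqrt (a * t)}) \<in> borel_measurable lborel"
      by measurable
    then show ?thesis .
  qed
  note [measurable] = meas[OF assms(2) Y]
  have [measurable]: "?pX k \<in> borel_measurable lborel" if "k \<in> {1..n}" for k
    using meas[OF assms(1) X] that by simp
  have "(\<Sum>k=1..n. \<integral>\<^sup>+\<omega>. ennreal (min ((X k \<omega>)\<^sup>2 / a) 1) \<partial>M) =
      (\<Sum>k=1..n. \<integral>\<^sup>+t. indicator {0<..<1} t * ennreal (?pX k t) \<partial>lborel)"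
    using X \<open>a > 0\<close> by (intro sum.cong refl M.nn_integral_min_square_layer_cake) auto
  also have "\<dots> = (\<integral>\<^sup>+t. (\<Sum>k=1..n. indicator {0<..<1} t * ennreal (?pX k t)) \<partial>lborel)"
    by (intro nn_integral_sum[symmetric]) measurable
  also have "\<dots> \<le> (\<integral>\<^sup>+t. ennreal (C * n) * (indicator {0<..<1} t * ennreal (?pY t)) \<partial>lborel)"
  proof (rule nn_integral_mono)
    fix t :: real
    show "(\<Sum>k=1..n. indicator {0<..<1} t * ennreal (?pX k t))
        \<le> ennreal (C * n) * (indicator {0<..<1} t * ennreal (?pY t))"
    proof (cases "t \<in> {0<..<1}")
      case True
      \<comment> \<open>Excluding \<open>t = 0\<close> makes the level \<open>sqrt (a * t)\<close>
        positive, as \<open>dom\<close> requires.\<close>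
      then have "(\<Sum>k=1..n. ?pX k t) \<le> C * n * ?pY t"
        using dom[of "sqrt (a * t)"] \<open>a > 0\<close> \<open>n \<ge> 1\<close> by (simp add: field_simps)
      then show ?thesis
        using True \<open>C > 0\<close> by (simp add: sum_ennreal ennreal_leI flip: ennreal_mult)
    qed simp
  qed
  also have "\<dots> = ennreal (C * n) * (\<integral>\<^sup>+t. indicator {0<..<1} t * ennreal (?pY t) \<partial>lborel)"
    by (rule nn_integral_cmult) measurable
  also have "(\<integral>\<^sup>+t. indicator {0<..<1} t * ennreal (?pY t) \<partial>lborel) =
      (\<integral>\<^sup>+\<omega>. ennreal (min ((Y \<omega>)\<^sup>2 / a) 1) \<partial>N)"
    using Y \<open>a > 0\<close> by (rule N.nn_integral_min_square_layer_cake[symmetric])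
  finally show ?thesis .
qed

section \<open>Almost sure decay of normalised sums of squares\<close>

text \<open>The numerator is nondecreasing in \<open>n\<close>, so passing to the next power of two
  costs at most the factor \<open>2 powr q\<close> from the denominator.\<close>

lemma sum_squares_div_powr_tendsto_0:
  fixes x :: "nat \<Rightarrow> real" and q :: real
  assumes "q > 0"
    and lim: "(\<lambda>m. \<Sum>k=1..2 ^ m. min ((x k)\<^sup>2 / (2 ^ m) powr q) 1) \<longlonglongrightarrow> 0"
  shows "(\<lambda>n. (\<Sum>k=1..n. (x k)\<^sup>2) / n powr q) \<longlonglongrightarrow> 0"
proof -
  define T where "T m = (\<Sum>k=1..2 ^ m. (x k)\<^sup>2) / (2 ^ m) powr q" for m :: nat
  \<comment> \<open>The value 1 is the truncation level: a nonnegative sum below 1 has all its terms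
    below 1, so every minimum is its first argument.\<close>
  have "\<forall>\<^sub>F m in sequentially. (\<Sum>k=1..2 ^ m. min ((x k)\<^sup>2 / (2 ^ m) powr q) 1) < 1"
    using order_tendstoD(2)[OF lim] by simp
  then have "\<forall>\<^sub>F m in sequentially. (\<Sum>k=1..2 ^ m. min ((x k)\<^sup>2 / (2 ^ m) powr q) 1) = T m"
  proof eventually_elim
    case (elim m)
    have "min ((x k)\<^sup>2 / (2 ^ m) powr q) 1 = (x k)\<^sup>2 / (2 ^ m) powr q" if "k \<in> {1..2 ^ m}" for k
    proof -
      have "min ((x k)\<^sup>2 / (2 ^ m) powr q) 1 \<le> (\<Sum>k=1..2 ^ m. min ((x k)\<^sup>2 / (2 ^ m) powr q) 1)"
        using that by (intro member_le_sum) auto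
      then show ?thesis using elim by linarith
    qed
    then show ?case by (simp add: T_def sum_divide_distrib)
  qed
  then have T: "T \<longlonglongrightarrow> 0" using lim by (rule Lim_transform_eventually[rotated])
  have "filterlim floor_log at_top sequentially"
    unfolding filterlim_at_top
  proof
    fix Z :: nat
    show "\<forall>\<^sub>F n in sequentially. Z \<le> floor_log n"
      using eventually_ge_at_top[of "2 ^ Z"]
      by eventually_elim (metis floor_log_le_iff floor_log_power)
  qed
  then have "(\<lambda>n. T (floor_log n + 1)) \<longlonglongrightarrow> 0"
    using filterlim_compose[OF LIMSEQ_ignore_initial_segment[OF T, of 1]] by simp
  then have "(\<lambda>n. 2 powr q * T (floor_log n + 1)) \<longlonglongrightarrow> 0"
    using tendsto_mult_right_zero by blast
  then show ?thesis
  proof (rule tendsto_sandwich[OF _ _ tendsto_const, rotated 2])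
    show "\<forall>\<^sub>F n in sequentially. 0 \<le> (\<Sum>k=1..n. (x k)\<^sup>2) / n powr q"
      by (simp add: sum_nonneg)
    show "\<forall>\<^sub>F n in sequentially.
        (\<Sum>k=1..n. (x k)\<^sup>2) / n powr q \<le> 2 powr q * T (floor_log n + 1)"
      using eventually_gt_at_top[of 0]
    proof eventually_elim
      case (elim n)
      \<comment> \<open>With the \<open>+ 1\<close>, \<open>2 ^ m\<close> lies between
        \<open>n\<close> and \<open>2 * n\<close>: the first bound extends the sum, the second
        controls the denominator.\<close>
      define m where "m = floor_log n + 1"
      have m: "n \<le> 2 ^ m" "2 ^ m \<le> 2 * n"
        using floor_log_exp2_ge[of n] floor_log_exp2_le[of n] elim by (auto simp: m_def)
      have "(2 ^ m) powr q \<le> (2 * real n) powr q"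
        using m(2) \<open>q > 0\<close> by (intro powr_mono2) (simp_all flip: of_nat_le_iff[where 'a = real])
      then have "(2 ^ m) powr q \<le> 2 powr q * n powr q" by (simp add: powr_mult)
      then have "1 / n powr q \<le> 2 powr q / (2 ^ m) powr q"
        using elim by (simp add: field_simps)
      moreover have "(\<Sum>k=1..n. (x k)\<^sup>2) \<le> (\<Sum>k=1..2 ^ m. (x k)\<^sup>2)"
        using m(1) by (intro sum_mono2) auto
      ultimately have "(\<Sum>k=1..n. (x k)\<^sup>2) * (1 / n powr q)
          \<le> (\<Sum>k=1..2 ^ m. (x k)\<^sup>2) * (2 powr q / (2 ^ m) powr q)"
        by (intro mult_mono) (auto simp: sum_nonneg)
      then show ?case by (simp add: T_def m_def mult_ac)
    qed
  qed
qed

text \<open>Expectation is additive whatever the joint law of the \<open>X k\<close>, so the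
  expectations of the truncated dyadic sums can be added up. A finite total makes the sums
  themselves almost surely summable in \<open>m\<close>, hence null.\<close>

lemma AE_sum_squares_div_powr_tendsto_0:
  fixes X :: "nat \<Rightarrow> 'a \<Rightarrow> real" and Y :: "'b \<Rightarrow> real"
  assumes "prob_space M" "prob_space N"
    and X: "\<And>k. k \<ge> 1 \<Longrightarrow> X k \<in> borel_measurable M" and Y: "Y \<in> borel_measurable N"
    and "C > 0" "0 < p" "p < 2"
    and dom: "\<And>x n. x > 0 \<Longrightarrow> n \<ge> 1 \<Longrightarrow>
           1 / real n * (\<Sum>k=1..n. measure M {\<omega> \<in> space M. \<bar>X k \<omega>\<bar> > x})
             \<le> C * measure N {\<omega> \<in> space N. \<bar>Y \<omega>\<bar> > x}"
    and Yp: "integrable N (\<lambda>\<omega>. \<bar>Y \<omega>\<bar> powr p)"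
  shows "AE \<omega> in M. (\<lambda>n. (\<Sum>k=1..n. (X k \<omega>)\<^sup>2) / n powr (2 / p)) \<longlonglongrightarrow> 0"
proof -
  define q where "q = 2 / p"
  have q: "q > 1" using assms by (simp add: q_def)
  define W where "W m \<omega> = (\<Sum>k=1..2 ^ m. min ((X k \<omega>)\<^sup>2 / (2 ^ m) powr q) 1)" for m \<omega>
  \<comment> \<open>\<open>V m (Y \<omega>)\<close> is the counterpart of
    \<open>W m \<omega>\<close> after domination; the factor \<open>2 ^ m\<close> counts the
    summands of \<open>W m\<close>.\<close>
  define V where "V m y = 2 ^ m * min (y\<^sup>2 / (2 ^ m) powr q) 1" for m and y :: real
  define K where "K = 1 / (1 - 2 powr (1 - q)) + 2"
  have X': "X k \<in> borel_measurable M" if "k \<in> {1..2 ^ m}" for k m using X that by simp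
  note [measurable] = Y
  have [measurable]: "(\<lambda>\<omega>. min ((X k \<omega>)\<^sup>2 / (2 ^ m) powr q) 1) \<in> borel_measurable M"
    if "k \<in> {1..2 ^ m}" for k m
    using X'[OF that] by measurable
  have W_meas [measurable]: "W m \<in> borel_measurable M" for m
    unfolding W_def by measurable
  have V_meas [measurable]: "V m \<in> borel_measurable borel" for m
    unfolding V_def by measurable
  have W_nonneg: "W m \<omega> \<ge> 0" for m \<omega> by (simp add: W_def sum_nonneg)
  have V_nonneg: "V m y \<ge> 0" for m y by (simp add: V_def)
  \<comment> \<open>The \<open>norm\<close> gives the majorant the shape in which integrability
    yields a finite nonnegative integral.\<close>
  have V_sum: "(\<Sum>m<n. V m y) \<le> norm (K * \<bar>y\<bar> powr p)" for n y
  proof -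
    \<comment> \<open>Since \<open>p * q = 2\<close>, the terms of the dyadic series at
      \<open>s = \<bar>y\<bar> powr p\<close> are exactly the \<open>V m y\<close>.\<close>
    have "(\<bar>y\<bar> powr p / 2 ^ m) powr q = y\<^sup>2 / (2 ^ m) powr q" for m
      using \<open>0 < p\<close> by (cases "y = 0") (auto simp: powr_divide powr_powr q_def)
    then show ?thesis
      using sum_min_dyadic_powr_le[OF q, of "\<bar>y\<bar> powr p" n]
      by (simp add: V_def K_def del: norm_mult)
  qed
  have W_le: "(\<integral>\<^sup>+\<omega>. W m \<omega> \<partial>M) \<le> C * (\<integral>\<^sup>+\<omega>. V m (Y \<omega>) \<partial>N)" for m
  proof -
    have "(\<integral>\<^sup>+\<omega>. W m \<omega> \<partial>M) =
        (\<Sum>k=1..2 ^ m. \<integral>\<^sup>+\<omega>. ennreal (min ((X k \<omega>)\<^sup>2 / (2 ^ m) powr q) 1) \<partial>M)"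
      unfolding W_def by (subst nn_integral_sum[symmetric]) (auto simp: sum_ennreal)
    also have "\<dots> \<le> ennreal (C * real (2 ^ m)) *
        (\<integral>\<^sup>+\<omega>. ennreal (min ((Y \<omega>)\<^sup>2 / (2 ^ m) powr q) 1) \<partial>N)"
      using dom by (intro sum_nn_integral_min_square_le assms) auto
    also have "\<dots> = C * (\<integral>\<^sup>+\<omega>. V m (Y \<omega>) \<partial>N)"
      using \<open>C > 0\<close> by (simp add: V_def ennreal_mult nn_integral_cmult mult_ac)
    finally show ?thesis .
  qed
  have "(\<integral>\<^sup>+\<omega>. (\<Sum>m. ennreal (W m \<omega>)) \<partial>M) = (\<Sum>m. \<integral>\<^sup>+\<omega>. W m \<omega> \<partial>M)"
    by (rule nn_integral_suminf) measurable
  also have "\<dots> \<le> C * (\<integral>\<^sup>+\<omega>. norm (K * \<bar>Y \<omega>\<bar> powr p) \<partial>N)"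
    \<comment> \<open>Bounding the partial sums is enough, because \<open>V_sum\<close> is uniform
      in their length.\<close>
    unfolding suminf_eq_SUP
  proof (rule SUP_least)
    fix n
    have "(\<Sum>m<n. \<integral>\<^sup>+\<omega>. W m \<omega> \<partial>M) \<le> (\<Sum>m<n. C * (\<integral>\<^sup>+\<omega>. V m (Y \<omega>) \<partial>N))"
      by (intro sum_mono W_le)
    also have "\<dots> = C * (\<integral>\<^sup>+\<omega>. (\<Sum>m<n. V m (Y \<omega>)) \<partial>N)"
      by (simp add: V_nonneg nn_integral_sum flip: sum_distrib_left sum_ennreal)
    also have "\<dots> \<le> C * (\<integral>\<^sup>+\<omega>. norm (K * \<bar>Y \<omega>\<bar> powr p) \<partial>N)"
      by (intro mult_left_mono nn_integral_mono ennreal_leI V_sum) simp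
    finally show "(\<Sum>m<n. \<integral>\<^sup>+\<omega>. W m \<omega> \<partial>M) \<le> C * (\<integral>\<^sup>+\<omega>. norm (K * \<bar>Y \<omega>\<bar> powr p) \<partial>N)" .
  qed
  also have "\<dots> < \<infinity>"
  proof -
    have "(\<integral>\<^sup>+\<omega>. norm (K * \<bar>Y \<omega>\<bar> powr p) \<partial>N) < \<infinity>"
      using integrable_mult_right[OF Yp] unfolding integrable_iff_bounded by blast
    then show ?thesis by (simp add: ennreal_mult_less_top del: norm_mult real_norm_def)
  qed
  finally have "AE \<omega> in M. (\<Sum>m. ennreal (W m \<omega>)) \<noteq> \<infinity>"
    by (intro nn_integral_noteq_infinite) auto
  then show ?thesis
  proof eventually_elim
    case (elim \<omega>)
    then have "summable (\<lambda>m. W m \<omega>)"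
      using summable_suminf_not_top[of "\<lambda>m. W m \<omega>"] W_nonneg by simp
    then have "(\<lambda>m. W m \<omega>) \<longlonglongrightarrow> 0" by (rule summable_LIMSEQ_zero)
    then show ?case
      using sum_squares_div_powr_tendsto_0[of q "\<lambda>k. X k \<omega>"] q \<open>0 < p\<close>
      by (simp add: W_def q_def)
  qed
qed

section \<open>Moments of linear forms on the sphere\<close>

text \<open>An elementary substitute for Jensen's inequality: up to \<open>l\<close> the first term
  suffices; above \<open>l\<close> the second does, because \<open>p - 2 < 0\<close> makes
  \<open>t powr (p - 2)\<close> decreasing in \<open>t\<close>.\<close>

lemma powr_le_powr_add:
  fixes t l p :: real
  assumes "t \<ge> 0" "l > 0" "0 < p" "p < 2"
  shows "t powr p \<le> l powr p + l powr (p - 2) * t\<^sup>2"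
proof (cases "t \<le> l")
  case True
  then have "t powr p \<le> l powr p" using assms by (intro powr_mono2) auto
  then show ?thesis by (simp add: add_increasing2)
next
  case False
  then have "t powr (p - 2) \<le> l powr (p - 2)" using assms by (intro powr_mono2') auto
  moreover have "t powr p = t powr (p - 2) * t\<^sup>2"
    using False assms by (simp add: powr_diff flip: powr_numeral)
  ultimately show ?thesis by (simp add: add_increasing mult_right_mono)
qed

text \<open>Expanding the square and summing over the row index first leaves the Gram matrix of the
  columns, which is the identity. Hence orthogonal maps send the sphere into itself.\<close>

lemma sum_squares_apply_coeffs:
  assumes "orthogonal_coeffs n A"
  shows "(\<Sum>i=1..n. (apply_coeffs n A u i)\<^sup>2) = (\<Sum>i=1..n. (u i)\<^sup>2)"
proof -
  have "(\<Sum>i=1..n. (apply_coeffs n A u i)\<^sup>2) =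
      (\<Sum>i=1..n. \<Sum>j=1..n. \<Sum>k=1..n. u j * u k * (A i j * A i k))"
    by (simp add: apply_coeffs_def power2_eq_square sum_product algebra_simps)
  also have "\<dots> = (\<Sum>j=1..n. \<Sum>i=1..n. \<Sum>k=1..n. u j * u k * (A i j * A i k))"
    by (rule sum.swap)
  also have "\<dots> = (\<Sum>j=1..n. \<Sum>k=1..n. \<Sum>i=1..n. u j * u k * (A i j * A i k))"
    by (intro sum.cong refl sum.swap)
  also have "\<dots> = (\<Sum>j=1..n. \<Sum>k=1..n. if j = k then (u j)\<^sup>2 else 0)"
    using assms unfolding orthogonal_coeffs_def
    by (intro sum.cong refl) (simp add: power2_eq_square flip: sum_distrib_left)
  also have "\<dots> = (\<Sum>j=1..n. (u j)\<^sup>2)"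
    by simp
  finally show ?thesis .
qed

context
  fixes n :: nat and P :: "(nat \<Rightarrow> real) measure"
  assumes P: "uniform_on_sphere n P"
begin

interpretation prob_space P using P by (simp add: uniform_on_sphere_def)

lemma sets_uniform_on_sphere: "sets P = sets (borel_sphere n)"
  using P by (simp add: uniform_on_sphere_def)

lemma space_uniform_on_sphere: "space P = unit_sphere n"
  using sets_eq_imp_space_eq[OF sets_uniform_on_sphere]
  by (auto simp: borel_sphere_def space_restrict_space space_PiM unit_sphere_def)

lemma measurable_coord_uniform_on_sphere [measurable]:
  assumes "k \<in> {1..n}"
  shows "(\<lambda>u. u k) \<in> borel_measurable P"
proof -
  have "(\<lambda>u. u k) \<in> borel_measurable (borel_sphere n)"
    unfolding borel_sphere_def
    by (intro measurable_restrict_space1 measurable_component_singleton assms)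
  then show ?thesis using measurable_cong_sets[OF sets_uniform_on_sphere refl] by blast
qed

lemma measurable_apply_coeffs:
  assumes "orthogonal_coeffs n A"
  shows "apply_coeffs n A \<in> P \<rightarrow>\<^sub>M P"
proof -
  have "apply_coeffs n A \<in> P \<rightarrow>\<^sub>M borel_sphere n"
    unfolding borel_sphere_def
  proof (rule measurable_restrict_space2)
    \<comment> \<open>Besides the norm, extensionality has to be checked; the restricted abstraction
      in \<open>apply_coeffs\<close> provides it.\<close>
    show "apply_coeffs n A \<in> space P \<rightarrow> unit_sphere n"
      using sum_squares_apply_coeffs[OF assms]
      by (auto simp: space_uniform_on_sphere unit_sphere_def) (auto simp: apply_coeffs_def)
    show "apply_coeffs n A \<in> P \<rightarrow>\<^sub>M (\<Pi>\<^sub>M k\<in>{1..n}. borel)"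
      unfolding apply_coeffs_def by (intro measurable_restrict) measurable
  qed
  then show ?thesis using measurable_cong_sets[OF refl sets_uniform_on_sphere] by blast
qed

lemma integral_apply_coeffs:
  fixes f :: "(nat \<Rightarrow> real) \<Rightarrow> real"
  assumes A: "orthogonal_coeffs n A" and "f \<in> borel_measurable P"
  shows "(\<integral>u. f (apply_coeffs n A u) \<partial>P) = (\<integral>u. f u \<partial>P)"
proof -
  have "distr P P (apply_coeffs n A) = P" using P A by (simp add: uniform_on_sphere_def)
  then show ?thesis
    using integral_distr[OF measurable_apply_coeffs[OF A] assms(2)] by simp
qed

lemma abs_coord_le_1:
  assumes "u \<in> space P" "k \<in> {1..n}"
  shows "\<bar>u k\<bar> \<le> 1"
proof -
  have "(u k)\<^sup>2 \<le> (\<Sum>i=1..n. (u i)\<^sup>2)" using assms(2) by (intro member_le_sum) auto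
  then show ?thesis
    using assms by (simp add: space_uniform_on_sphere unit_sphere_def abs_square_le_1)
qed

lemma integrable_coord_mult:
  assumes "i \<in> {1..n}" "j \<in> {1..n}"
  shows "integrable P (\<lambda>u. u i * u j)"
proof (rule integrable_const_bound[where B = 1])
  show "AE u in P. norm (u i * u j) \<le> 1"
    using abs_coord_le_1 assms by (auto simp: abs_mult intro!: mult_le_one)
qed (use assms in measurable)

text \<open>Reflecting coordinate \<open>i\<close> preserves \<open>P\<close> and flips the sign of
  the integrand, so the integral is its own negative.\<close>

lemma integral_coord_mult_eq_0:
  assumes "i \<in> {1..n}" "j \<in> {1..n}" "i \<noteq> j"
  shows "(\<integral>u. u i * u j \<partial>P) = 0"
proof -
  let ?A = "\<lambda>k l. if k = l then if k = i then -1 else 1 else 0 :: real"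
  have "orthogonal_coeffs n ?A"
    by (auto simp: orthogonal_coeffs_def if_distrib[of "\<lambda>x. x * _"] cong: if_cong)
  moreover have "apply_coeffs n ?A u i = - u i" "apply_coeffs n ?A u j = u j" for u
    using assms by (simp_all add: apply_coeffs_def if_distrib[of "\<lambda>x. x * _"] cong: if_cong)
  ultimately show ?thesis
    using integral_apply_coeffs[of ?A "\<lambda>u. u i * u j"] assms by simp
qed

text \<open>Swapping two coordinates preserves \<open>P\<close>, so all \<open>n\<close> second
  moments agree; on the sphere they add up to 1.\<close>

lemma integral_coord_square:
  assumes i: "i \<in> {1..n}"
  shows "(\<integral>u. u i * u i \<partial>P) = 1 / n"
proof -
  have swap: "(\<integral>u. u j * u j \<partial>P) = (\<integral>u. u i * u i \<partial>P)" if j: "j \<in> {1..n}" for j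
  proof -
    let ?A = "\<lambda>k l. if Transposition.transpose i j k = l then 1 else 0 :: real"
    have "(\<Sum>k=1..n. ?A k a * ?A k b) = (if a = b then 1 else 0 :: real)" if "a \<in> {1..n}" for a b
    proof -
      \<comment> \<open>Reindexing the rows by the transposition, a bijection of
        \<open>{1..n}\<close>, turns the permutation matrix into the identity matrix.\<close>
      have "(\<Sum>k=1..n. ?A k a * ?A k b) =
          (\<Sum>k=1..n. (if k = a then 1 else 0) * (if k = b then 1 else 0))"
        using i j by (intro sum.reindex_bij_betw bij_betw_transpose_iff) auto
      also have "\<dots> = (\<Sum>k=1..n. if k = a then if a = b then 1 else 0 else 0)"
        by (intro sum.cong) auto
      finally show ?thesis using that by simp
    qed
    then have "orthogonal_coeffs n ?A" unfolding orthogonal_coeffs_def by blast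
    moreover have "apply_coeffs n ?A u i = u j" for u
      using i j by (simp add: apply_coeffs_def if_distrib[of "\<lambda>x. x * _"] cong: if_cong)
    ultimately show ?thesis
      using integral_apply_coeffs[of ?A "\<lambda>u. u i * u i"] i by simp
  qed
  have "n * (\<integral>u. u i * u i \<partial>P) = (\<Sum>j=1..n. \<integral>u. u j * u j \<partial>P)" using swap by simp
  also have "\<dots> = (\<integral>u. (\<Sum>j=1..n. u j * u j) \<partial>P)"
    by (intro Bochner_Integration.integral_sum[symmetric] integrable_coord_mult)
  also have "\<dots> = (\<integral>u. 1 \<partial>P)"
    by (intro Bochner_Integration.integral_cong refl)
      (simp add: space_uniform_on_sphere unit_sphere_def power2_eq_square)
  finally show ?thesis using i by (simp add: prob_space field_simps)
qed

text \<open>The second moment matrix of \<open>P\<close> is the identity divided by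
  \<open>n\<close>, so only the diagonal of the expanded square survives.\<close>

lemma integral_linear_form_square:
  "integrable P (\<lambda>u. (\<Sum>k=1..n. u k * x k)\<^sup>2)"
  "(\<integral>u. (\<Sum>k=1..n. u k * x k)\<^sup>2 \<partial>P) = (\<Sum>k=1..n. (x k)\<^sup>2) / n"
proof -
  have eq: "(\<Sum>k=1..n. u k * x k)\<^sup>2 = (\<Sum>i=1..n. \<Sum>j=1..n. x i * x j * (u i * u j))" for u
    by (simp add: power2_eq_square sum_product algebra_simps)
  show "integrable P (\<lambda>u. (\<Sum>k=1..n. u k * x k)\<^sup>2)"
    unfolding eq
    by (intro Bochner_Integration.integrable_sum integrable_mult_right integrable_coord_mult)
  have "(\<integral>u. (\<Sum>k=1..n. u k * x k)\<^sup>2 \<partial>P) =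
      (\<Sum>i=1..n. \<Sum>j=1..n. x i * x j * (\<integral>u. u i * u j \<partial>P))"
  proof -
    have "(\<integral>u. (\<Sum>k=1..n. u k * x k)\<^sup>2 \<partial>P) =
        (\<Sum>i=1..n. \<integral>u. (\<Sum>j=1..n. x i * x j * (u i * u j)) \<partial>P)"
      unfolding eq
      by (intro Bochner_Integration.integral_sum Bochner_Integration.integrable_sum
          integrable_mult_right integrable_coord_mult)
    also have "\<dots> = (\<Sum>i=1..n. \<Sum>j=1..n. \<integral>u. x i * x j * (u i * u j) \<partial>P)"
      by (intro sum.cong refl Bochner_Integration.integral_sum
          integrable_mult_right integrable_coord_mult)
    finally show ?thesis by simp
  qed
  also have "\<dots> = (\<Sum>i=1..n. \<Sum>j=1..n. if i = j then (x i)\<^sup>2 / n else 0)"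
    by (intro sum.cong refl)
      (auto simp: integral_coord_mult_eq_0 integral_coord_square power2_eq_square)
  finally show "(\<integral>u. (\<Sum>k=1..n. u k * x k)\<^sup>2 \<partial>P) = (\<Sum>k=1..n. (x k)\<^sup>2) / n"
    by (simp add: sum_divide_distrib)
qed

lemma integral_linear_form_powr_le:
  assumes "0 < p" "p < 2"
  shows "(\<integral>u. \<bar>\<Sum>k=1..n. u k * x k\<bar> powr p \<partial>P) \<le> 2 * ((\<Sum>k=1..n. (x k)\<^sup>2) / n) powr (p / 2)"
proof (cases "(\<Sum>k=1..n. (x k)\<^sup>2) / n = 0")
  \<comment> \<open>The scale \<open>l\<close> chosen in the other case must be positive; here the
    linear form vanishes for every \<open>u\<close>.\<close>
  case True
  then have "n = 0 \<or> (\<forall>k\<in>{1..n}. x k = 0)" by (auto simp: sum_nonneg_eq_0_iff)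
  then have "(\<Sum>k=1..n. u k * x k) = 0" for u by auto
  then show ?thesis by simp
next
  case False
  \<comment> \<open>The root mean square of the linear form under \<open>P\<close>. With this choice
    both terms of \<open>powr_le_powr_add\<close> have expectation \<open>l powr p\<close>, whence
    the constant 2.\<close>
  define l where "l = sqrt ((\<Sum>k=1..n. (x k)\<^sup>2) / n)"
  have S: "(\<Sum>k=1..n. (x k)\<^sup>2) / n > 0"
  proof -
    have "(\<Sum>k=1..n. (x k)\<^sup>2) / n \<ge> 0" by (intro divide_nonneg_nonneg sum_nonneg) auto
    then show ?thesis using False by linarith
  qed
  then have l: "l > 0" "l\<^sup>2 = (\<Sum>k=1..n. (x k)\<^sup>2) / n" by (simp_all add: l_def)
  let ?S = "\<lambda>u. \<Sum>k=1..n. u k * x k"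
  have "(\<integral>u. \<bar>?S u\<bar> powr p \<partial>P) \<le> (\<integral>u. l powr p + l powr (p - 2) * (?S u)\<^sup>2 \<partial>P)"
  proof (rule integral_mono')
    show "integrable P (\<lambda>u. l powr p + l powr (p - 2) * (?S u)\<^sup>2)"
      by (intro Bochner_Integration.integrable_add integrable_mult_right
          integral_linear_form_square) simp
  qed (use powr_le_powr_add[of "\<bar>_\<bar>" l p] l(1) assms in auto)
  also have "\<dots> = l powr p + l powr (p - 2) * l\<^sup>2"
    using integral_linear_form_square[of x]
    by (simp add: Bochner_Integration.integral_add prob_space l(2))
  also have "l powr (p - 2) * l\<^sup>2 = l powr p"
    using l(1) by (simp add: powr_diff flip: powr_numeral)
  also have "l powr p = ((\<Sum>k=1..n. (x k)\<^sup>2) / n) powr (p / 2)"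
    using S unfolding l_def by (simp add: powr_half_sqrt[symmetric] powr_powr)
  finally show ?thesis by simp
qed

end

section \<open>From sums of squares to spherical averages\<close>

theorem corollary3p2:
  fixes M :: "'a measure" and N :: "'b measure"
    and X :: "nat \<Rightarrow> 'a \<Rightarrow> real" and Y :: "'b \<Rightarrow> real"
    and P :: "nat \<Rightarrow> (nat \<Rightarrow> real) measure"
    and C p :: real
  assumes "prob_space M" and "prob_space N"
    and "\<And>k. k \<ge> 1 \<Longrightarrow> X k \<in> borel_measurable M"
    and "Y \<in> borel_measurable N"
    and "\<And>n. n \<ge> 2 \<Longrightarrow> uniform_on_sphere n (P n)"
    and "C > 0"
    and "\<And>(x::real) (n::nat). x > 0 \<Longrightarrow> n \<ge> 1 \<Longrightarrow>
           1 / real n * (\<Sum>k=1..n. measure M {\<omega> \<in> space M. \<bar>X k \<omega>\<bar> > x})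
             \<le> C * measure N {\<omega> \<in> space N. \<bar>Y \<omega>\<bar> > x}"
    and "1 < p" and "p < 2"
    and "integrable N (\<lambda>\<omega>. \<bar>Y \<omega>\<bar> powr p * log_plus \<bar>Y \<omega>\<bar>)"
  shows "AE \<omega> in M.
           (\<lambda>n. real n powr (p / 2 - 1) * (\<integral>u. \<bar>\<Sum>k=1..n. u k * X k \<omega>\<bar> powr p \<partial>P n))
             \<longlonglongrightarrow> 0"
proof -
  \<comment> \<open>Above \<open>exp 1\<close> the factor \<open>log_plus\<close> is at least 1, and
    up to there the power is at most \<open>exp p\<close>, a constant integrable over a probability
    space.\<close>
  have "integrable N (\<lambda>\<omega>. \<bar>Y \<omega>\<bar> powr p)"
  proof (rule Bochner_Integration.integrable_bound)
    interpret N: prob_space N by fact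
    show "integrable N (\<lambda>\<omega>. exp p + \<bar>Y \<omega>\<bar> powr p * log_plus \<bar>Y \<omega>\<bar>)"
      using assms(10) by simp
    have "y powr p \<le> exp p + y powr p * log_plus y" if "y \<ge> 0" for y
    proof (cases "y \<le> exp 1")
      case True
      then have "y powr p \<le> exp 1 powr p" using that \<open>1 < p\<close> by (intro powr_mono2) auto
      moreover have "log_plus y \<ge> 0" by (simp add: log_plus_def)
      ultimately show ?thesis by (simp add: powr_def[of "exp 1"] add_increasing2)
    next
      case False
      then have "y > 0" "ln y \<ge> 1"
        using less_trans[OF exp_gt_zero, of 1 y] by (simp_all add: ln_ge_iff)
      then have "log_plus y \<ge> 1" by (simp add: log_plus_def)
      then have "y powr p * 1 \<le> y powr p * log_plus y" by (intro mult_left_mono) auto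
      then show ?thesis by (simp add: add_increasing)
    qed
    from this[of "\<bar>Y _\<bar>"]
    show "AE \<omega> in N. norm (\<bar>Y \<omega>\<bar> powr p)
        \<le> norm (exp p + \<bar>Y \<omega>\<bar> powr p * log_plus \<bar>Y \<omega>\<bar>)"
      by (intro AE_I2) (simp add: order_trans[OF _ abs_ge_self])
  qed (use assms(4) in measurable)
  then have "AE \<omega> in M. (\<lambda>n. (\<Sum>k=1..n. (X k \<omega>)\<^sup>2) / n powr (2 / p)) \<longlonglongrightarrow> 0"
    using assms by (intro AE_sum_squares_div_powr_tendsto_0[where Y = Y and N = N and C = C]) auto
  then show ?thesis
  proof eventually_elim
    case (elim \<omega>)
    let ?S = "\<lambda>n. \<Sum>k=1..n. (X k \<omega>)\<^sup>2"
    \<comment> \<open>The exponent \<open>p / 2\<close> matches the one in the spherical moment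
      bound and turns the denominator \<open>n powr (2 / p)\<close> into \<open>n\<close>.\<close>
    have "(\<lambda>n. (?S n / n powr (2 / p)) powr (p / 2)) \<longlonglongrightarrow> 0"
      using \<open>1 < p\<close> by (intro tendsto_zero_powrI[OF elim tendsto_const]) (auto simp: sum_nonneg)
    then have lim: "(\<lambda>n. 2 * (?S n / n powr (2 / p)) powr (p / 2)) \<longlonglongrightarrow> 0"
      using tendsto_mult_right_zero by blast
    show ?case
    proof (rule tendsto_sandwich[OF _ _ tendsto_const lim])
      show "\<forall>\<^sub>F n in sequentially.
          0 \<le> n powr (p / 2 - 1) * (\<integral>u. \<bar>\<Sum>k=1..n. u k * X k \<omega>\<bar> powr p \<partial>P n)"
        by simp
      show "\<forall>\<^sub>F n in sequentially.
          n powr (p / 2 - 1) * (\<integral>u. \<bar>\<Sum>k=1..n. u k * X k \<omega>\<bar> powr p \<partial>P n)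
            \<le> 2 * (?S n / n powr (2 / p)) powr (p / 2)"
        \<comment> \<open>\<open>P n\<close> is known to be uniform only from \<open>n = 2\<close>
          on, which is harmless for the limit.\<close>
        using eventually_ge_at_top[of 2]
      proof eventually_elim
        case (elim n)
        have "n powr (p / 2 - 1) * (\<integral>u. \<bar>\<Sum>k=1..n. u k * X k \<omega>\<bar> powr p \<partial>P n)
            \<le> n powr (p / 2 - 1) * (2 * (?S n / n) powr (p / 2))"
          using assms elim by (intro mult_left_mono integral_linear_form_powr_le) auto
        \<comment> \<open>Both sides equal \<open>2 * ?S n powr (p / 2) / n\<close>, as the
          exponents of \<open>n\<close> add up to \<open>(p / 2 - 1) - p / 2 = - 1\<close>.\<close>
        also have "\<dots> = 2 * (?S n / n powr (2 / p)) powr (p / 2)"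
          using elim \<open>1 < p\<close> by (simp add: powr_divide powr_powr powr_diff sum_nonneg)
        finally show ?case .
      qed
    qed
  qed
qed

end
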